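(* Let $T$ be an ergodic measure preserving map on the nonatomic probability space $(X,\mathcal{A},\mu)$, let $(A_l)$ be an asymptotically rare sequence in $\mathcal{A}$, let $(\mathfrak{F},d_{\mathfrak{F}})$ be a compact metric space, and let $\widetilde\Psi$ be any $\mathfrak{F}$-valued stationary sequence. Then there is a sequence $(\psi_{A_l})$ of local observables $\psi_{A_l}:A_l\to\mathfrak{F}$ such that $\widetilde\Psi_{A_l}\overset{\mu_{A_l}}{\Longrightarrow}\widetilde\Psi$ as $l\to\infty$.
   Context: For $A\in\mathcal{A}$ with $\mu(A)>0$: $\varphi_A(x):=\inf\{n\ge1:T^nx\in A\}$, $T_Ax:=T^{\varphi_A(x)}x$, $\mu_A:=\mu(A\cap\cdot)/\mu(A)$. Asymptotically rare: $0<\mu(A_l)\to0$. A local observable on $A$ is a measurable map $\psi_A:A\to\mathfrak{F}$, and $\widetilde\Psi_A:=(\psi_A,\psi_A\circ T_A,\psi_A\circ T_A^2,\ldots):A\to\mathfrak{F}^{\mathbb{N}_0}$ (product topology). $\widetilde\Psi_{A_l}\overset{\mu_{A_l}}{\Longrightarrow}\widetilde\Psi$ means the law of $\widetilde\Psi_{A_l}$ under $\mu_{A_l}$ converges weakly to the law of $\widetilde\Psi$. *)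

theory Defs
  imports "HOL-Probability.Probability"
begin

definition measure_preserving :: "'a measure \<Rightarrow> ('a \<Rightarrow> 'a) \<Rightarrow> bool" where
  "measure_preserving M T \<longleftrightarrow> T \<in> measurable M M \<and> distr M M T = M"

definition ergodic :: "'a measure \<Rightarrow> ('a \<Rightarrow> 'a) \<Rightarrow> bool" where
  "ergodic M T \<longleftrightarrow> (\<forall>A\<in>sets M. T -` A \<inter> space M = A \<longrightarrow>
      measure M A = 0 \<or> measure M A = 1)"

definition nonatomic :: "'a measure \<Rightarrow> bool" where
  "nonatomic M \<longleftrightarrow> (\<forall>A\<in>sets M. 0 < measure M A \<longrightarrow>
      (\<exists>B\<in>sets M. B \<subseteq> A \<and> 0 < measure M B \<and> measure M B < measure M A))"

text \<open>First return time (set to 0 where no return occurs; a null set on A)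
  and first return map.\<close>

definition return_time :: "('a \<Rightarrow> 'a) \<Rightarrow> 'a set \<Rightarrow> 'a \<Rightarrow> nat" where
  "return_time T A x =
     (if \<exists>n\<ge>1. (T ^^ n) x \<in> A then LEAST n. n \<ge> 1 \<and> (T ^^ n) x \<in> A else 0)"

definition return_map :: "('a \<Rightarrow> 'a) \<Rightarrow> 'a set \<Rightarrow> 'a \<Rightarrow> 'a" where
  "return_map T A x = (T ^^ return_time T A x) x"

definition cond_measure :: "'a measure \<Rightarrow> 'a set \<Rightarrow> 'a measure" where
  "cond_measure M A = scale_measure (ennreal (1 / measure M A)) (restrict_space M A)"

definition induced_process ::
  "('a \<Rightarrow> 'a) \<Rightarrow> 'a set \<Rightarrow> ('a \<Rightarrow> 'f) \<Rightarrow> 'a \<Rightarrow> (nat \<Rightarrow> 'f)" where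
  "induced_process T A \<psi> x = (\<lambda>n. \<psi> ((return_map T A ^^ n) x))"

definition weak_conv ::
  "(nat \<Rightarrow> 'b::topological_space measure) \<Rightarrow> 'b measure \<Rightarrow> bool" where
  "weak_conv Ms N \<longleftrightarrow> (\<forall>f :: 'b \<Rightarrow> real. continuous_on UNIV f \<and> bounded (range f) \<longrightarrow>
      (\<lambda>l. integral\<^sup>L (Ms l) f) \<longlonglongrightarrow> integral\<^sup>L N f)"

end

theory Submission
  imports Defs
begin

text \<open>
  The first return map \<open>S\<close> preserves the normalised measure on \<open>A\<close>, and almost every point of \<open>A\<close>
  visits any given subset of positive measure under \<open>S\<close>. Quantise the target process to a finite
  alphabet. Pick a set \<open>E\<close> of tiny positive measure, let \<open>r\<close> be the time until the \<open>S\<close>-orbit enters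
  \<open>E\<close>, and let \<open>R\<close> be the set where \<open>L\<close> divides \<open>r\<close>: off a set of measure at most \<open>L * \<mu> E\<close>,
  exactly one of the first \<open>L\<close> points of an orbit lies in \<open>R\<close>. Since the space is nonatomic, the
  points of \<open>R\<close> can be labelled by words of length \<open>L\<close> distributed like the first \<open>L\<close> symbols of
  the target. Each orbit segment of length \<open>L\<close> ending in \<open>R\<close> then reads off the word at its end
  point, which needs no invertibility of \<open>S\<close>. Stationarity makes the \<open>N\<close>-block statistics
  correct up to an error of order \<open>N / L + L\<^sup>2 * \<mu> E\<close>.
\<close>

section \<open>Sequences over a finite alphabet\<close>

text \<open>The product metric is a weighted sum over an enumeration of the coordinates, bounded by
  twice the maximum of the first terms plus a tail \<open>(1/2)^k\<close>. Bounds \<open>e/4\<close>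
  and \<open>e/2\<close> on these add up to \<open>e\<close>.\<close>

lemma dist_fun_less_of_coordinates:
  fixes e :: real
  assumes "e > 0"
  obtains N :: nat and d :: real where "d > 0"
    "\<And>x y :: nat \<Rightarrow> 'f::metric_space. (\<And>i. i < N \<Longrightarrow> dist (x i) (y i) < d) \<Longrightarrow> dist x y < e"
proof -
  obtain k :: nat where k: "(1/2::real)^k < e/2"
    using real_arch_pow_inv[of "e/2" "1/2"] assms by auto
  \<comment> \<open>The metric enumerates coordinates by \<open>from_nat\<close>, so
    \<open>N\<close> has to exceed the images of the indices up to \<open>k\<close>, not just
    \<open>k\<close>.\<close>
  define N where "N = Suc (Max ((from_nat :: nat \<Rightarrow> nat) ` {..k}))"
  have N: "from_nat n < N" if "n \<le> k" for n
    unfolding N_def using that by (intro le_imp_less_Suc Max_ge) auto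
  show ?thesis
  proof (rule that[of "e/4" N])
    fix x y :: "nat \<Rightarrow> 'f"
    assume *: "\<And>i. i < N \<Longrightarrow> dist (x i) (y i) < e/4"
    have "{dist (x (from_nat n)) (y (from_nat n)) |n. n \<le> k} =
        (\<lambda>n. dist (x (from_nat n)) (y (from_nat n))) ` {..k}"
      by auto
    then have "Max {dist (x (from_nat n)) (y (from_nat n)) |n. n \<le> k} < e/4"
      using * N by (simp only:, subst Max_less_iff) auto
    then show "dist x y < e"
      using dist_fun_le_dist_first_terms[of x y k] k by simp
  qed (use assms in auto)
qed

lemma open_fun_contains_cylinder:
  fixes U :: "(nat \<Rightarrow> 'f::metric_space) set"
  assumes "open U" "x \<in> U"
  obtains N where "\<And>z. (\<And>i. i < N \<Longrightarrow> z i = x i) \<Longrightarrow> z \<in> U"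
proof -
  obtain e where e: "e > 0" "\<And>z. dist z x < e \<Longrightarrow> z \<in> U"
    using assms by (auto simp: open_dist)
  obtain N d where "d > 0"
    "\<And>x y :: nat \<Rightarrow> 'f. (\<And>i. i < N \<Longrightarrow> dist (x i) (y i) < d) \<Longrightarrow> dist x y < e"
    using dist_fun_less_of_coordinates[OF e(1), where 'f='f] by metis
  then show ?thesis
    using e(2) that[of N] by auto
qed

text \<open>Blocks are padded with a fixed value instead of being made lists: they stay in the type
  of sequences, so that a function of sequences can be evaluated on them, and a finite alphabet
  yields finitely many of them.\<close>

definition cutoff :: "nat \<Rightarrow> (nat \<Rightarrow> 'f) \<Rightarrow> nat \<Rightarrow> 'f" where
  "cutoff N x = (\<lambda>i. if i < N then x i else undefined)"

lemma cutoff_eqI: "(\<And>i. i < N \<Longrightarrow> x i = y i) \<Longrightarrow> cutoff N x = cutoff N y"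
  by (auto simp: cutoff_def)

lemma finite_cutoff_range:
  assumes "finite F" "\<And>x i. x \<in> A \<Longrightarrow> X i x \<in> F"
  shows "finite ((\<lambda>x. cutoff N (\<lambda>i. X i x)) ` A)"
proof (rule finite_subset)
  show "(\<lambda>x. cutoff N (\<lambda>i. X i x)) ` A \<subseteq>
      {f. \<forall>i. (i \<in> {..<N} \<longrightarrow> f i \<in> F) \<and> (i \<notin> {..<N} \<longrightarrow> f i = undefined)}"
    using assms(2) by (auto simp: cutoff_def)
qed (use assms(1) in \<open>intro finite_set_of_finite_funs; simp\<close>)

text \<open>Measurability into the discrete space concerns preimages of arbitrary sets of blocks.
  Only finitely many blocks occur, so preimages of singletons suffice, and these are finite
  intersections of coordinate conditions.\<close>

lemma measurable_cutoff:
  assumes X: "\<And>i. X i \<in> measurable M (count_space UNIV)"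
    and F: "finite F" "\<And>x i. x \<in> space M \<Longrightarrow> X i x \<in> F"
  shows "(\<lambda>x. cutoff N (\<lambda>i. X i x)) \<in> measurable M (count_space UNIV)"
proof -
  define V where "V = (\<lambda>x. cutoff N (\<lambda>i. X i x)) ` space M"
  have "(\<lambda>x. cutoff N (\<lambda>i. X i x)) \<in> measurable M (count_space V)"
  proof (subst measurable_count_space_eq2)
    show "finite V"
      unfolding V_def using F by (intro finite_cutoff_range)
    have "(\<lambda>x. cutoff N (\<lambda>i. X i x)) -` {v} \<inter> space M \<in> sets M" if "v \<in> V" for v
    proof -
      from that obtain x0 where "v = cutoff N (\<lambda>i. X i x0)" by (auto simp: V_def)
      then have "(\<lambda>x. cutoff N (\<lambda>i. X i x)) -` {v} \<inter> space M =
          {x \<in> space M. \<forall>i\<in>{..<N}. X i x = v i}"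
        by (auto simp: cutoff_def fun_eq_iff) metis+
      also have "\<dots> \<in> sets M"
      proof (intro sets.sets_Collect_finite_All)
        fix i
        have "X i -` {v i} \<inter> space M \<in> sets M"
          by (rule measurable_sets[OF X]) simp
        also have "X i -` {v i} \<inter> space M = {x \<in> space M. X i x = v i}" by auto
        finally show "{x \<in> space M. X i x = v i} \<in> sets M" .
      qed auto
      finally show ?thesis .
    qed
    then show "(\<lambda>x. cutoff N (\<lambda>i. X i x)) \<in> space M \<rightarrow> V \<and>
        (\<forall>v\<in>V. (\<lambda>x. cutoff N (\<lambda>i. X i x)) -` {v} \<inter> space M \<in> sets M)"
      by (auto simp: V_def)
  qed
  then show ?thesis
    by (rule measurable_compose) simp
qed

text \<open>A point of an open set \<open>U\<close> has an initial block all of whose extensions lie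
  in \<open>U\<close>. Hence \<open>U\<close> is a countable union of conditions on finite blocks,
  to which measurability of \<open>cutoff\<close> applies.\<close>

lemma borel_measurable_finite_alphabet_process:
  fixes X :: "nat \<Rightarrow> 'a \<Rightarrow> 'f::metric_space"
  assumes X: "\<And>i. X i \<in> measurable M (count_space UNIV)"
    and F: "finite F" "\<And>x i. x \<in> space M \<Longrightarrow> X i x \<in> F"
  shows "(\<lambda>x i. X i x) \<in> measurable M borel"
proof (rule borel_measurableI)
  fix U :: "(nat \<Rightarrow> 'f) set"
  assume U: "open U"
  define C where "C N = {v. \<forall>z. (\<forall>i<N. z i = v i) \<longrightarrow> z \<in> U}" for N
  have "x \<in> U \<longleftrightarrow> (\<exists>N. cutoff N x \<in> C N)" for x
  proof
    assume "x \<in> U"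
    from open_fun_contains_cylinder[OF U this] obtain N
      where "\<And>z. (\<And>i. i < N \<Longrightarrow> z i = x i) \<Longrightarrow> z \<in> U" by metis
    then show "\<exists>N. cutoff N x \<in> C N"
      by (intro exI[of _ N]) (auto simp: C_def cutoff_def)
  qed (auto simp: C_def cutoff_def)
  then have "(\<lambda>x i. X i x) -` U \<inter> space M =
      (\<Union>N. (\<lambda>x. cutoff N (\<lambda>i. X i x)) -` C N \<inter> space M)"
    by auto
  also have "\<dots> \<in> sets M"
    using measurable_cutoff[where X=X and M=M, OF X F]
    by (intro sets.countable_UN image_subsetI measurable_sets) auto
  finally show "(\<lambda>x i. X i x) -` U \<inter> space M \<in> sets M" .
qed

section \<open>Nonatomic probability spaces\<close>

text \<open>Repeated halving: a proper part \<open>C\<close> of \<open>B\<close> or its complement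
  \<open>B - C\<close> has at most half the measure of \<open>B\<close>, and both are
  positive.\<close>

lemma nonatomic_small_subset:
  assumes "prob_space M" "nonatomic M" "A \<in> sets M" "0 < measure M A" "0 < e"
  obtains B where "B \<in> sets M" "B \<subseteq> A" "0 < measure M B" "measure M B \<le> e"
proof -
  interpret prob_space M by fact
  have "\<exists>B\<in>sets M. B \<subseteq> A \<and> 0 < measure M B \<and> measure M B \<le> (1/2)^n" for n
  proof (induction n)
    case 0
    show ?case using assms by (intro bexI[of _ A]) auto
  next
    case (Suc n)
    then obtain B where B: "B \<in> sets M" "B \<subseteq> A" "0 < measure M B" "measure M B \<le> (1/2)^n"
      by auto
    then obtain C where C: "C \<in> sets M" "C \<subseteq> B" "0 < measure M C" "measure M C < measure M B"
      using \<open>nonatomic M\<close> unfolding nonatomic_def by blast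
    have D: "measure M (B - C) = measure M B - measure M C"
      using B C by (intro finite_measure_Diff) auto
    show ?case
    proof (cases "measure M C \<le> measure M B / 2")
      case True
      then show ?thesis using B C by (intro bexI[of _ C]) auto
    next
      case False
      then show ?thesis using B C D by (intro bexI[of _ "B - C"]) auto
    qed
  qed
  moreover obtain n :: nat where "(1/2::real)^n < e"
    using real_arch_pow_inv[of e "1/2"] assms by auto
  ultimately show ?thesis using that by (meson less_imp_le order_trans)
qed

theorem nonatomic_subset_of_measure:
  assumes "prob_space M" "nonatomic M" and R: "R \<in> sets M" and c: "0 \<le> c" "c \<le> measure M R"
  obtains G where "G \<in> sets M" "G \<subseteq> R" "measure M G = c"
proof -
  interpret prob_space M by fact
  \<comment> \<open>Greedy exhaustion: every step adds at least half of the largest admissible amount.\<close>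
  define P where "P G \<longleftrightarrow> G \<in> sets M \<and> G \<subseteq> R \<and> measure M G \<le> c" for G
  define Q where "Q G G' \<longleftrightarrow> G \<subseteq> G' \<and> (\<forall>E\<in>sets M. E \<subseteq> R - G \<longrightarrow> measure M E \<le> c - measure M G
      \<longrightarrow> measure M E \<le> 2 * (measure M G' - measure M G))" for G G'
  have step: "\<exists>G'. P G' \<and> Q G G'" if "P G" for G
  proof -
    define S where "S = measure M ` {E \<in> sets M. E \<subseteq> R - G \<and> measure M E \<le> c - measure M G}"
    have "{} \<in> {E \<in> sets M. E \<subseteq> R - G \<and> measure M E \<le> c - measure M G}"
      using that by (auto simp: P_def)
    then have ne: "S \<noteq> {}" unfolding S_def by blast
    have bdd: "bdd_above S" unfolding S_def by (intro bdd_aboveI[of _ 1]) auto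
    show ?thesis
    proof (cases "Sup S \<le> 0")
      case True
      then have "measure M E \<le> 0" if "E \<in> sets M" "E \<subseteq> R - G" "measure M E \<le> c - measure M G" for E
        using cSup_upper[OF _ bdd, of "measure M E"] that unfolding S_def by force
      then show ?thesis using that by (intro exI[of _ G]) (auto simp: Q_def)
    next
      case False
      then obtain y where "y \<in> S" "Sup S / 2 < y"
        using less_cSup_iff[OF ne bdd, of "Sup S / 2"] by auto
      then obtain E where E: "E \<in> sets M" "E \<subseteq> R - G" "measure M E \<le> c - measure M G"
        "Sup S / 2 < measure M E" by (auto simp: S_def)
      have m: "measure M (G \<union> E) = measure M G + measure M E"
        using E that by (intro finite_measure_Union) (auto simp: P_def)
      have "measure M E' \<le> 2 * (measure M (G \<union> E) - measure M G)"
        if "E' \<in> sets M" "E' \<subseteq> R - G" "measure M E' \<le> c - measure M G" for E'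
        using cSup_upper[OF _ bdd, of "measure M E'"] that E(4) m unfolding S_def by force
      then show ?thesis using that E m
        by (intro exI[of _ "G \<union> E"]) (auto simp: Q_def P_def)
    qed
  qed
  have "\<exists>G. \<forall>n. P (G n) \<and> Q (G n) (G (Suc n))"
    by (rule dependent_nat_choice[of "\<lambda>_. P" "\<lambda>_. Q"]) (use step c in \<open>auto simp: P_def intro: exI[of _ "{}"]\<close>)
  then obtain G where P: "\<And>n. P (G n)" and Q: "\<And>n. Q (G n) (G (Suc n))" by auto
  define H where "H = (\<Union>n. G n)"
  have H: "H \<in> sets M" "H \<subseteq> R" using P by (auto simp: H_def P_def)
  have inc: "incseq G" using Q by (intro incseq_SucI) (auto simp: Q_def)
  have lim: "(\<lambda>n. measure M (G n)) \<longlonglongrightarrow> measure M H"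
    unfolding H_def using P inc by (intro finite_Lim_measure_incseq) (auto simp: P_def)
  have le: "measure M H \<le> c"
    by (rule LIMSEQ_le_const2[OF lim]) (use P in \<open>auto simp: P_def\<close>)
  have "measure M H = c"
  proof (rule ccontr)
    assume "measure M H \<noteq> c"
    with le have lt: "measure M H < c" by simp
    have "measure M (R - H) = measure M R - measure M H"
      using R H by (intro finite_measure_Diff) auto
    then obtain E where E: "E \<in> sets M" "E \<subseteq> R - H" "0 < measure M E" "measure M E \<le> c - measure M H"
      using nonatomic_small_subset[OF assms(1,2), of "R - H" "c - measure M H"] R H lt c by auto
    \<comment> \<open>The set \<open>E\<close> is disjoint from every \<open>G n\<close> and fits
      into every remaining budget, so it competes at each step. Each increment is then at least half
      of \<open>measure M E\<close>, although the increments tend to zero.\<close>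
    have "measure M E \<le> 2 * (measure M (G (Suc n)) - measure M (G n))" for n
    proof -
      have "measure M (G n) \<le> measure M H"
        using H by (intro finite_measure_mono) (auto simp: H_def)
      then show ?thesis using Q[of n] E unfolding Q_def H_def by force
    qed
    moreover have "(\<lambda>n. 2 * (measure M (G (Suc n)) - measure M (G n))) \<longlonglongrightarrow> 2 * (measure M H - measure M H)"
      by (intro tendsto_intros lim LIMSEQ_Suc)
    ultimately have "measure M E \<le> 2 * (measure M H - measure M H)"
      by (intro LIMSEQ_le_const) auto
    then show False using E by simp
  qed
  then show ?thesis using H that by blast
qed

text \<open>Induction on \<open>V\<close>: carve a set of measure \<open>p v\<close> out of
  \<open>R\<close>, label it \<open>v\<close>, and label the rest recursively. Points outside
  \<open>R\<close> also receive labels in \<open>V\<close>, which keeps the range condition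
  global.\<close>

lemma nonatomic_labelling:
  assumes M: "prob_space M" "nonatomic M" and "finite V"
    and "R \<in> sets M" "\<And>v. v \<in> V \<Longrightarrow> 0 \<le> p v" "(\<Sum>v\<in>V. p v) = measure M R" "V \<noteq> {}"
  shows "\<exists>g. g \<in> measurable M (count_space UNIV) \<and> range g \<subseteq> V \<and>
    (\<forall>v\<in>V. measure M {x \<in> R. g x = v} = p v)"
  using assms(3-)
proof (induction V arbitrary: R rule: finite_induct)
  case (insert v V)
  interpret prob_space M by fact
  show ?case
  proof (cases "V = {}")
    case True
    then show ?thesis using insert.prems by (intro exI[of _ "\<lambda>_. v"]) auto
  next
    case False
    have s: "p v + (\<Sum>v\<in>V. p v) = measure M R" "(\<Sum>v\<in>V. p v) \<ge> 0"
      using insert by (auto intro: sum_nonneg)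
    then obtain G where G: "G \<in> sets M" "G \<subseteq> R" "measure M G = p v"
      using nonatomic_subset_of_measure[OF M insert.prems(1), of "p v"] insert.prems(2) by auto
    have "measure M (R - G) = (\<Sum>v\<in>V. p v)"
      using insert.prems(1) G s by (subst finite_measure_Diff) auto
    then obtain g where g: "g \<in> measurable M (count_space UNIV)" "range g \<subseteq> V"
      "\<And>w. w \<in> V \<Longrightarrow> measure M {x \<in> R - G. g x = w} = p w"
      using insert.IH[of "R - G"] insert.prems(1,2) False G(1) by (metis insertCI sets.Diff)
    have gv: "g x \<noteq> v" for x using g(2) insert.hyps by auto
    have eq: "{x \<in> R. (if x \<in> G then v else g x) = v} = G"
      "\<And>w. w \<in> V \<Longrightarrow> {x \<in> R. (if x \<in> G then v else g x) = w} = {x \<in> R - G. g x = w}"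
      using G(2) gv insert.hyps(2) by auto
    show ?thesis
    proof (intro exI[of _ "\<lambda>x. if x \<in> G then v else g x"] conjI ballI)
      show "(\<lambda>x. if x \<in> G then v else g x) \<in> measurable M (count_space UNIV)"
        using G(1) g(1) by (intro measurable_If_set) auto
      show "range (\<lambda>x. if x \<in> G then v else g x) \<subseteq> insert v V"
        using g(2) by auto
      show "measure M {x \<in> R. (if x \<in> G then v else g x) = w} = p w" if "w \<in> insert v V" for w
        using that eq(2)[of w] g(3)[of w] G(3) by (cases "w = v") (simp_all only: eq(1) insert_iff simp_thms)
    qed
  qed
qed simp

lemma integral_eq_sum_finite_range:
  fixes k :: "'b \<Rightarrow> real"
  assumes M: "prob_space M" and Y: "Y \<in> measurable M (count_space UNIV)" and "finite V"
    and R: "R \<in> sets M" and V: "\<And>x. x \<in> R \<Longrightarrow> Y x \<in> V"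
  shows "(\<integral>x. indicator R x * k (Y x) \<partial>M) = (\<Sum>v\<in>V. k v * measure M {x \<in> R. Y x = v})"
proof -
  interpret prob_space M by fact
  have s: "{x \<in> R. Y x = v} \<in> sets M" for v
  proof -
    have "{x \<in> R. Y x = v} = R \<inter> (Y -` {v} \<inter> space M)"
      using sets.sets_into_space[OF R] by auto
    then show ?thesis using R measurable_sets[OF Y, of "{v}"] by auto
  qed
  have "indicator R x * k (Y x) = (\<Sum>v\<in>V. k v * indicator {x \<in> R. Y x = v} x)" for x
  proof (cases "x \<in> R")
    case True
    then have "(\<Sum>v\<in>V. k v * indicator {x \<in> R. Y x = v} x) = (\<Sum>v\<in>V. if v = Y x then k v else 0)"
      by (intro sum.cong) auto
    then show ?thesis using V True \<open>finite V\<close> by simp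
  qed auto
  then have "(\<integral>x. indicator R x * k (Y x) \<partial>M) = (\<integral>x. (\<Sum>v\<in>V. k v * indicator {x \<in> R. Y x = v} x) \<partial>M)"
    by simp
  also have "\<dots> = (\<Sum>v\<in>V. k v * measure M {x \<in> R. Y x = v})"
    using s by (subst Bochner_Integration.integral_sum) (auto intro!: integrable_mult_right simp: emeasure_eq_measure
      intro!: sum.cong arg_cong[where f="measure M"] dest: sets.sets_into_space)
  finally show ?thesis .
qed

text \<open>Labelling with weights \<open>measure M R\<close> times the law of \<open>Y\<close>
  makes \<open>g\<close>, conditionally on \<open>R\<close>, a copy of \<open>Y\<close>. The
  integral form lets stationarity be applied later without sums over words.\<close>

lemma nonatomic_simulation:
  assumes M: "prob_space M" "nonatomic M" and R: "R \<in> sets M"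
    and Q: "prob_space Q" and Y: "Y \<in> measurable Q (count_space UNIV)" and "finite (Y ` space Q)"
  obtains g where "g \<in> measurable M (count_space UNIV)" "range g \<subseteq> Y ` space Q"
    "\<And>k :: _ \<Rightarrow> real. (\<integral>x. indicator R x * k (g x) \<partial>M) = measure M R * (\<integral>y. k (Y y) \<partial>Q)"
proof -
  interpret M: prob_space M by fact
  interpret Q: prob_space Q by fact
  let ?V = "Y ` space Q"
  let ?p = "\<lambda>v. measure M R * measure Q {y \<in> space Q. Y y = v}"
  have Y_int: "(\<integral>y. k (Y y) \<partial>Q) = (\<Sum>v\<in>?V. k v * measure Q {y \<in> space Q. Y y = v})" for k :: "_ \<Rightarrow> real"
  proof -
    have "(\<integral>y. k (Y y) \<partial>Q) = (\<integral>y. indicator (space Q) y * k (Y y) \<partial>Q)"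
      by (intro Bochner_Integration.integral_cong) auto
    then show ?thesis
      using integral_eq_sum_finite_range[OF Q Y assms(6), of "space Q" k] by simp
  qed
  have "(\<Sum>v\<in>?V. ?p v) = measure M R"
    using Y_int[of "\<lambda>_. 1"] by (simp add: sum_distrib_left[symmetric] Q.prob_space)
  then obtain g where g: "g \<in> measurable M (count_space UNIV)" "range g \<subseteq> ?V"
    "\<And>v. v \<in> ?V \<Longrightarrow> measure M {x \<in> R. g x = v} = ?p v"
    using nonatomic_labelling[OF M assms(6) R, of ?p] Q.not_empty by auto
  show ?thesis
  proof (rule that[OF g(1,2)])
    fix k :: "_ \<Rightarrow> real"
    have "(\<integral>x. indicator R x * k (g x) \<partial>M) = (\<Sum>v\<in>?V. k v * measure M {x \<in> R. g x = v})"
      using g(2) by (intro integral_eq_sum_finite_range M g(1) assms(6) R) auto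
    also have "\<dots> = measure M R * (\<integral>y. k (Y y) \<partial>Q)"
      unfolding Y_int using g(3) by (simp add: sum_distrib_left mult_ac)
    finally show "(\<integral>x. indicator R x * k (g x) \<partial>M) = measure M R * (\<integral>y. k (Y y) \<partial>Q)" .
  qed
qed

section \<open>Return maps\<close>

lemma measurable_funpow:
  assumes "measure_preserving M T"
  shows "T ^^ n \<in> measurable M M"
  using assms unfolding measure_preserving_def by (intro measurable_compose_n) auto

lemma distr_funpow:
  assumes "measure_preserving M T"
  shows "distr M M (T ^^ n) = M"
proof (induction n)
  case 0
  then show ?case by (simp add: id_def)
next
  case (Suc n)
  have "distr M M (T ^^ Suc n) = distr (distr M M (T ^^ n)) M T"
    using assms measurable_funpow[OF assms, of n]
    by (subst distr_distr) (auto simp: measure_preserving_def)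
  then show ?case using Suc assms by (simp only: measure_preserving_def)
qed

lemma integral_funpow:
  fixes f :: "'a \<Rightarrow> real"
  assumes "measure_preserving M T" "f \<in> borel_measurable M"
  shows "(\<integral>x. f ((T ^^ n) x) \<partial>M) = (\<integral>x. f x \<partial>M)"
  using integral_distr[OF measurable_funpow[OF assms(1), of n] assms(2)] distr_funpow[OF assms(1), of n]
  by simp

lemma measure_funpow_vimage:
  assumes "measure_preserving M T" "B \<in> sets M"
  shows "measure M ((T ^^ n) -` B \<inter> space M) = measure M B"
  using measure_distr[OF measurable_funpow[OF assms(1), of n] assms(2)] distr_funpow[OF assms(1), of n]
  by simp

lemma funpow_in_space:
  assumes "measure_preserving M T" "x \<in> space M"
  shows "(T ^^ n) x \<in> space M"
  using measurable_space[OF measurable_funpow[OF assms(1)] assms(2)] .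

text \<open>The set \<open>I\<close> of points visiting \<open>E\<close> infinitely often is exactly
  invariant, so its measure is 0 or 1. It is at least \<open>measure M E\<close>, because each
  \<open>U m\<close> contains the \<open>m\<close>-th preimage of \<open>E\<close>.\<close>

lemma ergodic_infinitely_often:
  assumes "prob_space M" and T: "measure_preserving M T" and "ergodic M T"
    and E: "E \<in> sets M" "0 < measure M E"
  shows "AE x in M. \<forall>m. \<exists>n\<ge>m. (T ^^ n) x \<in> E"
proof -
  interpret prob_space M by fact
  define U where "U m = (\<Union>n\<in>{m..}. (T ^^ n) -` E \<inter> space M)" for m
  define I where "I = (\<Inter>m. U m)"
  have pre: "(T ^^ n) -` E \<inter> space M \<in> sets M" for n
    by (rule measurable_sets[OF measurable_funpow[OF T] E(1)])
  have U: "U m \<in> sets M" for m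
    unfolding U_def using pre by (intro sets.countable_UN'') auto
  have I: "I \<in> sets M" unfolding I_def using U by auto
  have mem: "x \<in> I \<longleftrightarrow> x \<in> space M \<and> (\<forall>m. \<exists>n\<ge>m. (T ^^ n) x \<in> E)" for x
    unfolding I_def U_def by auto
  have shift: "(\<forall>m. \<exists>n\<ge>m. (T ^^ n) (T x) \<in> E) \<longleftrightarrow> (\<forall>m. \<exists>n\<ge>m. (T ^^ n) x \<in> E)" for x
  proof -
    have eq: "(T ^^ n) (T x) = (T ^^ Suc n) x" for n by (simp add: funpow_swap1)
    show ?thesis
    proof safe
      fix m
      assume *: "\<forall>m. \<exists>n\<ge>m. (T ^^ n) (T x) \<in> E"
      then obtain n where "n \<ge> m" "(T ^^ n) (T x) \<in> E" by blast
      then show "\<exists>n\<ge>m. (T ^^ n) x \<in> E" unfolding eq by (meson le_Suc_eq)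
    next
      fix m
      assume *: "\<forall>m. \<exists>n\<ge>m. (T ^^ n) x \<in> E"
      then obtain n where "n \<ge> Suc m" "(T ^^ n) x \<in> E" by blast
      then show "\<exists>n\<ge>m. (T ^^ n) (T x) \<in> E" unfolding eq
        by (intro exI[of _ "n - 1"]) auto
    qed
  qed
  have "T -` I \<inter> space M = I"
    using funpow_in_space[OF T, where n=1] by (auto simp: mem shift)
  then have "measure M I = 0 \<or> measure M I = 1"
    using \<open>ergodic M T\<close> I unfolding ergodic_def by blast
  moreover have "measure M E \<le> measure M I"
  proof (rule LIMSEQ_le_const)
    have "decseq U" unfolding U_def by (intro decseq_SucI) force
    then show "(\<lambda>m. measure M (U m)) \<longlonglongrightarrow> measure M I"
      unfolding I_def using U by (intro finite_Lim_measure_decseq) auto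
    have "measure M E \<le> measure M (U m)" for m
      unfolding measure_funpow_vimage[OF T E(1), of m, symmetric]
      using U by (intro finite_measure_mono) (auto simp: U_def)
    then show "\<exists>N. \<forall>n\<ge>N. measure M E \<le> measure M (U n)" by auto
  qed
  ultimately have "measure M I = 1" using E by auto
  then have "AE x in M. x \<in> I" using I by (subst prob_Collect_eq_1[symmetric]) (auto simp: Collect_conj_eq Int_absorb1 sets.sets_into_space)
  then show ?thesis by eventually_elim (simp add: mem)
qed

section \<open>The normalised measure on a subset\<close>

lemma space_cond_measure: "A \<in> sets M \<Longrightarrow> space (cond_measure M A) = A"
  unfolding cond_measure_def by (auto simp: space_scale_measure space_restrict_space dest: sets.sets_into_space)

lemma sets_cond_measure: "A \<in> sets M \<Longrightarrow> B \<in> sets (cond_measure M A) \<longleftrightarrow> B \<in> sets M \<and> B \<subseteq> A"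
  unfolding cond_measure_def by (auto simp: sets_restrict_space_iff)

lemma measure_cond_measure:
  assumes "A \<in> sets M" "B \<in> sets (cond_measure M A)"
  shows "measure (cond_measure M A) B = measure M B / measure M A"
proof -
  have "A \<inter> space M \<in> sets M" "B \<subseteq> A" using assms by (auto simp: sets_cond_measure)
  then show ?thesis
    by (simp add: cond_measure_def measure_def emeasure_restrict_space enn2real_mult)
qed

lemma prob_space_cond_measure:
  assumes "prob_space M" "A \<in> sets M" "0 < measure M A"
  shows "prob_space (cond_measure M A)"
proof
  interpret prob_space M by fact
  have "emeasure (cond_measure M A) A = ennreal (1 / measure M A) * emeasure M A"
    using assms by (simp add: cond_measure_def emeasure_restrict_space)
  also have "\<dots> = 1"
    using assms by (simp add: emeasure_eq_measure ennreal_mult[symmetric])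
  finally show "emeasure (cond_measure M A) (space (cond_measure M A)) = 1"
    using assms by (simp add: space_cond_measure)
qed

lemma nonatomic_cond_measure:
  assumes "nonatomic M" "A \<in> sets M" "0 < measure M A"
  shows "nonatomic (cond_measure M A)"
  unfolding nonatomic_def
proof (intro ballI impI)
  fix B assume B: "B \<in> sets (cond_measure M A)" "0 < measure (cond_measure M A) B"
  then have "B \<in> sets M" "0 < measure M B"
    using assms by (auto simp: sets_cond_measure measure_cond_measure zero_less_divide_iff)
  then obtain C where "C \<in> sets M" "C \<subseteq> B" "0 < measure M C" "measure M C < measure M B"
    using assms(1) unfolding nonatomic_def by blast
  then show "\<exists>C\<in>sets (cond_measure M A). C \<subseteq> B \<and> 0 < measure (cond_measure M A) C \<and>
      measure (cond_measure M A) C < measure (cond_measure M A) B"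
    using assms B by (intro bexI[of _ C]) (auto simp: sets_cond_measure measure_cond_measure divide_simps)
qed

lemma AE_cond_measure:
  assumes "A \<in> sets M" "AE x in M. Q x"
  shows "AE x in cond_measure M A. Q x"
proof -
  obtain N where N: "N \<in> null_sets M" "{x \<in> space M. \<not> Q x} \<subseteq> N"
    using assms(2) by (auto elim!: AE_E intro: that null_setsI)
  have "N \<inter> A \<in> null_sets (cond_measure M A)"
  proof (rule null_setsI)
    have "emeasure M (N \<inter> A) = 0"
      using null_set_Int2[OF N(1) assms(1)] by (simp add: null_sets_def Int_commute)
    then show "emeasure (cond_measure M A) (N \<inter> A) = 0"
      using assms(1) by (simp add: cond_measure_def emeasure_restrict_space)
  qed (use N assms in \<open>auto simp: sets_cond_measure\<close>)
  then show ?thesis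
    by (rule AE_I') (use N assms in \<open>auto simp: space_cond_measure dest: sets.sets_into_space\<close>)
qed

section \<open>Pointwise properties of the first return map\<close>

lemma return_map_cases:
  assumes "\<exists>n\<ge>1. (T ^^ n) x \<in> A"
  obtains k where "k \<ge> 1" "return_map T A x = (T ^^ k) x" "(T ^^ k) x \<in> A"
    "\<And>i. 1 \<le> i \<Longrightarrow> i < k \<Longrightarrow> (T ^^ i) x \<notin> A"
proof (rule that)
  let ?k = "LEAST n. n \<ge> 1 \<and> (T ^^ n) x \<in> A"
  show "?k \<ge> 1" "(T ^^ ?k) x \<in> A" using LeastI_ex[of "\<lambda>n. n \<ge> 1 \<and> (T ^^ n) x \<in> A"] assms by auto
  show "return_map T A x = (T ^^ ?k) x" using assms by (simp add: return_map_def return_time_def)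
  show "(T ^^ i) x \<notin> A" if "1 \<le> i" "i < ?k" for i using not_less_Least[OF that(2)] that(1) by auto
qed

lemma return_map_eqI:
  assumes "k \<ge> 1" "(T ^^ k) x \<in> A" "\<And>i. 1 \<le> i \<Longrightarrow> i < k \<Longrightarrow> (T ^^ i) x \<notin> A"
  shows "return_map T A x = (T ^^ k) x"
proof -
  have "(LEAST n. n \<ge> 1 \<and> (T ^^ n) x \<in> A) = k"
    using assms by (intro Least_equality) (auto simp: not_less[symmetric])
  then show ?thesis using assms by (auto simp: return_map_def return_time_def)
qed

text \<open>The default return time 0 makes the map the identity at points that never return, so
  this holds everywhere on \<open>A\<close> and not just almost everywhere.\<close>

lemma return_map_in:
  assumes "x \<in> A"
  shows "return_map T A x \<in> A"
proof (cases "\<exists>n\<ge>1. (T ^^ n) x \<in> A")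
  case True
  then show ?thesis by (metis return_map_cases)
next
  case False
  then have "return_time T A x = 0" by (simp only: return_time_def if_False)
  then show ?thesis using assms by (simp add: return_map_def)
qed

text \<open>Strong induction on the time: the first return happens at some \<open>j \<le> n\<close>,
  after which \<open>n - j\<close> steps remain. This transfers recurrence from \<open>T\<close> to
  the return map.\<close>

lemma funpow_return_map_hits:
  assumes "x \<in> A" "(T ^^ n) x \<in> A"
  shows "\<exists>k. (return_map T A ^^ k) x = (T ^^ n) x"
  using assms
proof (induction n arbitrary: x rule: less_induct)
  case (less n)
  show ?case
  proof (cases "n = 0")
    case True
    then show ?thesis by (intro exI[of _ 0]) simp
  next
    case False
    then have ex: "\<exists>n\<ge>1. (T ^^ n) x \<in> A" using less.prems by (intro exI[of _ n]) auto
    obtain j where j: "j \<ge> 1" "return_map T A x = (T ^^ j) x" "(T ^^ j) x \<in> A"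
      "\<And>i. 1 \<le> i \<Longrightarrow> i < j \<Longrightarrow> (T ^^ i) x \<notin> A"
      using return_map_cases[OF ex] by metis
    have "j \<le> n" using j(4)[of n] less.prems False by (meson leI less_one not_less)
    then have eq: "(T ^^ (n - j)) ((T ^^ j) x) = (T ^^ n) x"
      by (simp add: funpow_add[symmetric, THEN fun_cong, simplified])
    then obtain k where "(return_map T A ^^ k) ((T ^^ j) x) = (T ^^ n) x"
      using less.IH[of "n - j" "(T ^^ j) x"] j less.prems False by auto
    then show ?thesis using j(2) by (intro exI[of _ "Suc k"]) (simp add: funpow_swap1)
  qed
qed

section \<open>Decomposition by first return times\<close>

context
  fixes M :: "'a measure" and T :: "'a \<Rightarrow> 'a" and A :: "'a set"
  assumes M: "prob_space M" and T: "measure_preserving M T" and A: "A \<in> sets M"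
begin

interpretation prob_space M by (rule M)

definition first_return_set :: "'a set \<Rightarrow> nat \<Rightarrow> 'a set" where
  "first_return_set G k = {x \<in> A. (T ^^ k) x \<in> G \<and> (\<forall>i\<in>{1..<k}. (T ^^ i) x \<notin> A)}"

text \<open>Unlike above, the starting point ranges over the whole space and time 0 is included in
  the exclusion, so that for \<open>k = 0\<close> the set is \<open>G\<close> itself.\<close>

definition first_entry_set :: "'a set \<Rightarrow> nat \<Rightarrow> 'a set" where
  "first_entry_set G k = {x \<in> space M. (T ^^ k) x \<in> G \<and> (\<forall>i\<in>{..<k}. (T ^^ i) x \<notin> A)}"

lemma sets_first_entry_return:
  assumes "G \<in> sets M"
  shows "first_return_set G k \<in> sets M" "first_entry_set G k \<in> sets M"
proof -
  have [measurable]: "T ^^ i \<in> measurable M M" for i by (rule measurable_funpow[OF T])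
  note [measurable] = A assms
  have "first_return_set G k = {x \<in> space M. x \<in> A \<and> (T ^^ k) x \<in> G \<and> (\<forall>i\<in>{1..<k}. (T ^^ i) x \<notin> A)}"
    using sets.sets_into_space[OF A] by (auto simp: first_return_set_def)
  also have "\<dots> \<in> sets M" by measurable
  finally show "first_return_set G k \<in> sets M" .
  show "first_entry_set G k \<in> sets M" unfolding first_entry_set_def by measurable
qed

text \<open>The preimage under \<open>T\<close> of the points entering at time \<open>m\<close>
  splits by whether the point lies in \<open>A\<close>: inside, a first return at time
  \<open>m + 1\<close>; outside, a first entry at time \<open>m + 1\<close>. Invariance of the
  measure makes the identity telescope.\<close>

lemma measure_first_return_sum:
  assumes G: "G \<in> sets M"
  shows "measure M G = (\<Sum>k<m. measure M (first_return_set G (Suc k))) + measure M (first_entry_set G m)"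
proof (induction m)
  case 0
  have "first_entry_set G 0 = G" using sets.sets_into_space[OF G] by (auto simp: first_entry_set_def)
  then show ?case by simp
next
  case (Suc m)
  have *: "(\<forall>i\<in>{..<m}. (T ^^ i) (T x) \<notin> A) \<longleftrightarrow> (\<forall>i\<in>{1..<Suc m}. (T ^^ i) x \<notin> A)" for x
  proof -
    have "{1..<Suc m} = Suc ` {..<m}"
      by (simp only: One_nat_def image_Suc_atLeastLessThan lessThan_atLeast0)
    then show ?thesis by (simp add: funpow_swap1)
  qed
  have **: "(\<forall>i\<in>{..<Suc m}. (T ^^ i) x \<notin> A) \<longleftrightarrow> x \<notin> A \<and> (\<forall>i\<in>{1..<Suc m}. (T ^^ i) x \<notin> A)" for x
  proof -
    have "{..<Suc m} = insert 0 {1..<Suc m}" by auto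
    then show ?thesis by simp
  qed
  have "(T ^^ 1) -` first_entry_set G m \<inter> space M =
      first_return_set G (Suc m) \<union> first_entry_set G (Suc m)"
    using sets.sets_into_space[OF A] funpow_in_space[OF T, where n=1]
    unfolding first_entry_set_def first_return_set_def ** by (auto simp: * funpow_swap1)
  moreover have "first_return_set G (Suc m) \<inter> first_entry_set G (Suc m) = {}"
    unfolding first_entry_set_def first_return_set_def ** by auto
  ultimately have "measure M (first_entry_set G m) =
      measure M (first_return_set G (Suc m)) + measure M (first_entry_set G (Suc m))"
    using measure_funpow_vimage[OF T sets_first_entry_return(2)[OF G], of 1 m]
      sets_first_entry_return[OF G]
    by (simp add: finite_measure_Union)
  then show ?case using Suc by simp
qed

text \<open>The second set is the part where the default return time applies. Keeping it gives an
  exact identity, usable for measurability; recurrence makes it negligible in measure.\<close>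

lemma return_map_vimage:
  assumes "G \<subseteq> A"
  shows "return_map T A -` G \<inter> A = (\<Union>k. first_return_set G (Suc k)) \<union>
    {x \<in> G. \<forall>n\<ge>1. (T ^^ n) x \<notin> A}"
proof (intro set_eqI iffI)
  fix x assume x: "x \<in> return_map T A -` G \<inter> A"
  show "x \<in> (\<Union>k. first_return_set G (Suc k)) \<union> {x \<in> G. \<forall>n\<ge>1. (T ^^ n) x \<notin> A}"
  proof (cases "\<exists>n\<ge>1. (T ^^ n) x \<in> A")
    case True
    then obtain k where k: "k \<ge> 1" "return_map T A x = (T ^^ k) x" "(T ^^ k) x \<in> A"
      "\<And>i. 1 \<le> i \<Longrightarrow> i < k \<Longrightarrow> (T ^^ i) x \<notin> A" by (metis return_map_cases)
    then have "x \<in> first_return_set G (Suc (k - 1))"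
      using x by (auto simp: first_return_set_def)
    then show ?thesis by blast
  next
    case False
    then have "return_time T A x = 0" by (simp only: return_time_def if_False)
    then show ?thesis using False x by (auto simp: return_map_def)
  qed
next
  fix x assume "x \<in> (\<Union>k. first_return_set G (Suc k)) \<union> {x \<in> G. \<forall>n\<ge>1. (T ^^ n) x \<notin> A}"
  then show "x \<in> return_map T A -` G \<inter> A"
  proof
    assume "x \<in> (\<Union>k. first_return_set G (Suc k))"
    then obtain k where k: "x \<in> first_return_set G (Suc k)" by blast
    then have "return_map T A x = (T ^^ Suc k) x"
      using assms by (intro return_map_eqI) (auto simp: first_return_set_def)
    then show ?thesis using k by (auto simp: first_return_set_def)
  next
    assume x: "x \<in> {x \<in> G. \<forall>n\<ge>1. (T ^^ n) x \<notin> A}"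
    then have "return_time T A x = 0" by (auto simp: return_time_def)
    then show ?thesis using x assms by (auto simp: return_map_def)
  qed
qed

lemma measurable_return_map: "return_map T A \<in> measurable (cond_measure M A) (cond_measure M A)"
proof (rule measurableI)
  fix x assume "x \<in> space (cond_measure M A)"
  then show "return_map T A x \<in> space (cond_measure M A)"
    using return_map_in A by (simp add: space_cond_measure)
next
  fix G assume "G \<in> sets (cond_measure M A)"
  then have G: "G \<in> sets M" "G \<subseteq> A" using A by (auto simp: sets_cond_measure)
  have [measurable]: "T ^^ i \<in> measurable M M" for i by (rule measurable_funpow[OF T])
  note [measurable] = A G(1)
  have "{x \<in> G. \<forall>n\<ge>1. (T ^^ n) x \<notin> A} = {x \<in> space M. x \<in> G \<and> (\<forall>n\<in>{1..}. (T ^^ n) x \<notin> A)}"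
    using sets.sets_into_space[OF G(1)] by auto
  also have "\<dots> \<in> sets M" by measurable
  finally have "(\<Union>k. first_return_set G (Suc k)) \<union> {x \<in> G. \<forall>n\<ge>1. (T ^^ n) x \<notin> A} \<in> sets M"
    using sets_first_entry_return(1)[OF G(1)] by (intro sets.Un sets.countable_UN) auto
  then show "return_map T A -` G \<inter> space (cond_measure M A) \<in> sets (cond_measure M A)"
    unfolding space_cond_measure[OF A] sets_cond_measure[OF A] return_map_vimage[OF G(2), symmetric]
    by auto
qed

end

theorem measure_preserving_return_map:
  assumes M: "prob_space M" and T: "measure_preserving M T" and "ergodic M T"
    and A: "A \<in> sets M" "0 < measure M A"
  shows "measure_preserving (cond_measure M A) (return_map T A)"
proof -
  interpret prob_space M by (rule M)
  let ?P = "cond_measure M A" and ?S = "return_map T A"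
  interpret P: prob_space ?P by (rule prob_space_cond_measure[OF M A])
  note meas = measurable_return_map[OF M T A(1)]
  \<comment> \<open>Comparing \<open>G\<close> with its complement turns this inequality into an equality.\<close>
  have le: "measure ?P (?S -` G \<inter> space ?P) \<le> measure ?P G" if G': "G \<in> sets ?P" for G
  proof -
    have G: "G \<in> sets M" "G \<subseteq> A" using A G' by (auto simp: sets_cond_measure)
    let ?C = "\<lambda>k. first_return_set T A G (Suc k)"
    have C: "?C k \<in> sets M" for k by (rule sets_first_entry_return[OF M T A(1) G(1)])
    \<comment> \<open>Discarding the nonnegative entry term is what leaves only an
      inequality.\<close>
    have part: "(\<Sum>k<m. measure M (?C k)) \<le> measure M G" for m
      using measure_first_return_sum[OF M T A(1) G(1), of m] by simp
    have summ: "summable (\<lambda>k. measure M (?C k))"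
      by (rule summableI_nonneg_bounded[OF _ part]) simp
    have sub: "(\<Union>k. ?C k) \<in> sets M" using C by auto
    have pre: "?S -` G \<inter> A \<in> sets M"
      using measurable_sets[OF meas G'] A by (simp add: space_cond_measure sets_cond_measure)
    have "measure M (?S -` G \<inter> A) \<le> measure M (\<Union>k. ?C k)"
    proof (rule finite_measure_mono_AE)
      \<comment> \<open>Ergodicity enters here: almost every point returns to \<open>A\<close>, so
        the points fixed by the default value can be ignored.\<close>
      show "AE x in M. x \<in> ?S -` G \<inter> A \<longrightarrow> x \<in> (\<Union>k. ?C k)"
        using ergodic_infinitely_often[OF M T assms(3) A]
      proof eventually_elim
        case (elim x)
        then show ?case using return_map_vimage[OF M T A(1) G(2)] by blast
      qed
    qed (rule sub)
    also have "\<dots> \<le> (\<Sum>k. measure M (?C k))"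
      using C summ by (intro finite_measure_subadditive_countably) auto
    also have "\<dots> \<le> measure M G" by (rule suminf_le_const[OF summ part])
    finally show ?thesis
      using A G' pre by (simp add: space_cond_measure measure_cond_measure sets_cond_measure divide_right_mono)
  qed
  have eq: "measure ?P (?S -` G \<inter> space ?P) = measure ?P G" if G: "G \<in> sets ?P" for G
  proof -
    have "?S -` (space ?P - G) \<inter> space ?P = space ?P - (?S -` G \<inter> space ?P)"
      using measurable_space[OF meas] by auto
    then show ?thesis
      using le[OF G] le[of "space ?P - G"] G measurable_sets[OF meas G]
      by (simp add: P.prob_compl)
  qed
  have "distr ?P ?P ?S = ?P"
    by (rule measure_eqI) (use eq meas in \<open>auto simp: emeasure_distr P.emeasure_eq_measure\<close>)
  then show ?thesis using meas by (simp add: measure_preserving_def)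
qed

text \<open>Visits of the \<open>T\<close>-orbit to \<open>E\<close> are visits to \<open>A\<close>,
  hence appear in the orbit of the return map. In this form ergodicity is passed on to the coding
  argument.\<close>

lemma return_map_hits_AE:
  assumes M: "prob_space M" and T: "measure_preserving M T" and "ergodic M T"
    and A: "A \<in> sets M" "0 < measure M A"
    and E: "E \<in> sets (cond_measure M A)" "0 < measure (cond_measure M A) E"
  shows "AE x in cond_measure M A. \<exists>k. (return_map T A ^^ k) x \<in> E"
proof -
  have E': "E \<in> sets M" "E \<subseteq> A" "0 < measure M E"
    using A E by (auto simp: sets_cond_measure measure_cond_measure zero_less_divide_iff)
  have "AE x in cond_measure M A. \<forall>m. \<exists>n\<ge>m. (T ^^ n) x \<in> E"
    by (intro AE_cond_measure A ergodic_infinitely_often assms E')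
  then show ?thesis
    using AE_space
  proof eventually_elim
    case (elim x)
    then obtain n where "(T ^^ n) x \<in> E" by blast
    moreover have "\<exists>k. (return_map T A ^^ k) x = (T ^^ n) x"
      using calculation elim(2) E' A by (intro funpow_return_map_hits) (auto simp: space_cond_measure)
    ultimately show ?case by metis
  qed
qed

section \<open>Coding a finite-alphabet stationary process\<close>

text \<open>Return maps enter only through invariance and \<open>hit\<close>. A single
  \<open>\<psi>\<close> serves all bounded \<open>h\<close>, so the laws of the
  \<open>N\<close>-blocks are close uniformly over test functions; the factor 2 comes from centring
  \<open>h\<close>.\<close>

theorem finite_alphabet_approximation:
  fixes P :: "'a measure" and Q :: "'w measure" and X :: "nat \<Rightarrow> 'w \<Rightarrow> 'f"
  assumes P: "prob_space P" "nonatomic P" and S: "measure_preserving P S"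
    and hit: "\<And>E. E \<in> sets P \<Longrightarrow> 0 < measure P E \<Longrightarrow> AE x in P. \<exists>k. (S ^^ k) x \<in> E"
    and Q: "prob_space Q"
    and X: "\<And>i. X i \<in> measurable Q (count_space UNIV)"
    and F: "finite F" "\<And>w i. w \<in> space Q \<Longrightarrow> X i w \<in> F"
    and stat: "\<And>h :: (nat \<Rightarrow> 'f) \<Rightarrow> real. \<And>N j.
      (\<integral>w. h (cutoff N (\<lambda>i. X (i + j) w)) \<partial>Q) = (\<integral>w. h (cutoff N (\<lambda>i. X i w)) \<partial>Q)"
    and e: "0 < e"
  obtains \<psi> where "\<psi> \<in> measurable P (count_space UNIV)" "range \<psi> \<subseteq> F"
    "\<And>h :: (nat \<Rightarrow> 'f) \<Rightarrow> real. \<And>K. (\<And>x. \<bar>h x\<bar> \<le> K) \<Longrightarrow>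
       \<bar>(\<integral>x. h (cutoff N (\<lambda>i. \<psi> ((S ^^ i) x))) \<partial>P) - (\<integral>w. h (cutoff N (\<lambda>i. X i w)) \<partial>Q)\<bar> \<le> 2 * K * e"
proof -
  interpret P: prob_space P by fact
  interpret Q: prob_space Q by fact
  obtain L0 :: nat where L0: "2 * N / e < L0" using reals_Archimedean2 by blast
  define L where "L = max L0 (Suc N)"
  have L: "N < L" "L > 0" and NL: "N / L \<le> e / 2"
  proof -
    show "N < L" "L > 0" by (auto simp: L_def)
    have "2 * N / e \<le> L" using L0 by (simp add: L_def)
    then show "N / L \<le> e / 2" using e \<open>L > 0\<close> by (simp add: field_simps)
  qed
  \<comment> \<open>\<open>D\<close> is the total factor of \<open>measure P E\<close> in the final
    estimate: \<open>Bad\<close> costs \<open>L * measure P E\<close> and is weighted by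
    \<open>N + (1 + L)\<close>. The choice of \<open>E\<close> turns this into
    \<open>e / 2\<close>.\<close>
  define D :: real where "D = real N * real L + (1 + real L) * real L"
  have D: "D > 0" unfolding D_def using L by (intro add_nonneg_pos mult_pos_pos) auto
  obtain E where E: "E \<in> sets P" "0 < measure P E" "measure P E \<le> e / (2 * D)"
  proof (rule nonatomic_small_subset[OF P])
    show "space P \<in> sets P" "0 < measure P (space P)" "0 < e / (2 * D)"
      using e D by (simp_all add: P.prob_space)
  qed
  \<comment> \<open>Time 0 counts, so \<open>r\<close> vanishes on \<open>E\<close>. The value is
    arbitrary where \<open>E\<close> is never hit, a null set by \<open>hit\<close>.\<close>
  define r where "r y = (LEAST k. (S ^^ k) y \<in> E)" for y
  define R where "R = {y \<in> space P. L dvd r y}"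
  define Bad where "Bad = {y \<in> space P. \<exists>i\<in>{..<L}. (S ^^ i) y \<in> E}"
  have Sm [measurable]: "S ^^ i \<in> measurable P P" for i by (rule measurable_funpow[OF S])
  note [measurable] = E(1)
  have rm [measurable]: "r \<in> measurable P (count_space UNIV)" unfolding r_def by measurable
  have R [measurable]: "R \<in> sets P" unfolding R_def by measurable
  have Bad [measurable]: "Bad \<in> sets P" unfolding Bad_def by measurable
  have Y: "(\<lambda>w. cutoff n (\<lambda>i. X i w)) \<in> measurable Q (count_space UNIV)" for n
    by (rule measurable_cutoff[OF X F])
  have Yfin: "finite ((\<lambda>w. cutoff L (\<lambda>i. X i w)) ` space Q)"
    by (rule finite_cutoff_range[OF F])
  obtain g where g [measurable]: "g \<in> measurable P (count_space UNIV)"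
    and gr: "range g \<subseteq> (\<lambda>w. cutoff L (\<lambda>i. X i w)) ` space Q"
    and gi: "\<And>k :: _ \<Rightarrow> real. (\<integral>x. indicat_real R x * k (g x) \<partial>P) =
        measure P R * (\<integral>w. k (cutoff L (\<lambda>i. X i w)) \<partial>Q)"
    by (rule nonatomic_simulation[OF P R Q Y Yfin]) (rule that)
  \<comment> \<open>If the orbit of \<open>y\<close> hits \<open>E\<close>, it reaches
    \<open>R\<close> after \<open>r y mod L\<close> steps, and the word is taken from there. Letters
    are indexed backwards from \<open>L - 1\<close> at the end point, so they are read forwards in
    time.\<close>
  define \<psi> where "\<psi> y = g ((S ^^ (r y mod L)) y) (L - 1 - r y mod L)" for y
  have \<psi>m: "\<psi> \<in> measurable P (count_space UNIV)"
    unfolding \<psi>_def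
  \<comment> \<open>The number of steps depends on the point but takes countably many values, so
    each value \<open>j\<close> of \<open>r\<close> can be treated separately.\<close>
  proof (rule measurable_compose_countable[where g=r and f="\<lambda>j y. g ((S ^^ (j mod L)) y) (L - 1 - j mod L)"])
    show "(\<lambda>y. g ((S ^^ (j mod L)) y) (L - 1 - j mod L)) \<in> measurable P (count_space UNIV)" for j
      by (rule measurable_compose[OF measurable_compose[OF Sm g]]) simp
  qed (rule rm)
  have \<psi>F: "range \<psi> \<subseteq> F"
  proof safe
    fix y
    obtain w where "w \<in> space Q" "g ((S ^^ (r y mod L)) y) = cutoff L (\<lambda>i. X i w)" using gr by blast
    then show "\<psi> y \<in> F" using F(2) L by (simp add: \<psi>_def cutoff_def)
  qed
  have Bad_le: "measure P Bad \<le> L * (e / (2 * D))"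
  proof -
    have "Bad = (\<Union>i\<in>{..<L}. (S ^^ i) -` E \<inter> space P)" by (auto simp: Bad_def)
    also have "measure P \<dots> \<le> (\<Sum>i<L. measure P ((S ^^ i) -` E \<inter> space P))"
      by (intro P.finite_measure_subadditive_finite) (auto intro: measurable_sets[OF Sm])
    also have "\<dots> = L * measure P E" by (simp add: measure_funpow_vimage[OF S E(1)])
    also have "\<dots> \<le> L * (e / (2 * D))" using E(3) by (intro mult_left_mono) auto
    finally show ?thesis .
  qed
  have r_shift: "r ((S ^^ s) y) = r y - s" if "\<exists>k. (S ^^ k) y \<in> E" "s \<le> r y" for s y
  proof -
    have 1: "(S ^^ r y) y \<in> E" unfolding r_def using that(1) by (rule LeastI_ex)
    have add: "(S ^^ k) ((S ^^ s) y) = (S ^^ (k + s)) y" for k by (simp add: funpow_add)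
    show ?thesis unfolding r_def[of "(S ^^ s) y"] add
    proof (rule Least_equality)
      show "(S ^^ (r y - s + s)) y \<in> E" using 1 that(2) by simp
      fix k assume "(S ^^ (k + s)) y \<in> E"
      then have "r y \<le> k + s" unfolding r_def by (rule Least_le)
      then show "r y - s \<le> k" by simp
    qed
  qed
  have good: "L \<le> r y" if "\<exists>k. (S ^^ k) y \<in> E" "y \<in> space P - Bad" for y
  proof (rule ccontr)
    assume "\<not> L \<le> r y"
    moreover have "(S ^^ r y) y \<in> E" unfolding r_def using that(1) by (rule LeastI_ex)
    ultimately show False using that(2) by (auto simp: Bad_def)
  qed
  \<comment> \<open>Off \<open>Bad\<close> the time \<open>r\<close> drops by one at each of the
    first \<open>L\<close> steps, so it passes through each residue class modulo \<open>L\<close>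
    exactly once.\<close>
  have in_R: "(S ^^ s) y \<in> R \<longleftrightarrow> s = r y mod L"
    if y: "\<exists>k. (S ^^ k) y \<in> E" "y \<in> space P - Bad" and "s < L" for s y
  proof -
    have "(S ^^ s) y \<in> R \<longleftrightarrow> L dvd r y - s"
      using r_shift[OF y(1), of s] good[OF y] \<open>s < L\<close> y(2) funpow_in_space[OF S, of y s] by (auto simp: R_def)
    also have "\<dots> \<longleftrightarrow> r y mod L = s mod L"
      using good[OF y] \<open>s < L\<close> by (metis mod_eq_dvd_iff_nat less_imp_le order_trans)
    finally show ?thesis using \<open>s < L\<close> by auto
  qed
  have hitE: "AE y in P. \<exists>k. (S ^^ k) y \<in> E" by (rule hit[OF E(1,2)])
  have indR: "(\<integral>y. indicat_real R ((S ^^ s) y) \<partial>P) = measure P R" for s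
    using integral_funpow[OF S, of "indicat_real R" s] by simp
  have intR: "integrable P (\<lambda>y. indicat_real R ((S ^^ s) y))" for s
    by (rule P.integrable_const_bound[where B=1]) auto
  have intB: "integrable P (indicat_real Bad)"
    by (rule P.integrable_const_bound[where B=1]) auto
  \<comment> \<open>Integrate the number of visits to \<open>R\<close> during the first
    \<open>L\<close> steps: it is 1 off \<open>Bad\<close> and at most \<open>L\<close> on
    \<open>Bad\<close>.\<close>
  have bound_R: "L * measure P R \<le> 1 + L * measure P Bad"
  proof -
    have "L * measure P R = (\<integral>y. (\<Sum>s<L. indicat_real R ((S ^^ s) y)) \<partial>P)"
      by (subst Bochner_Integration.integral_sum) (auto simp: indR intR)
    also have "\<dots> \<le> (\<integral>y. 1 + L * indicat_real Bad y \<partial>P)"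
    proof (rule integral_mono_AE)
      show "AE y in P. (\<Sum>s<L. indicat_real R ((S ^^ s) y)) \<le> 1 + L * indicat_real Bad y"
        using hitE AE_space
      proof eventually_elim
        case (elim y)
        show ?case
        proof (cases "y \<in> Bad")
          case True
          have "(\<Sum>s<L. indicat_real R ((S ^^ s) y)) \<le> (\<Sum>s<L. 1)"
            by (intro sum_mono) (auto simp: indicator_def)
          then show ?thesis using True by simp
        next
          case False
          have "(\<Sum>s<L. indicat_real R ((S ^^ s) y)) = (\<Sum>s<L. if s = r y mod L then 1 else 0)"
            using in_R[of y] elim False by (intro sum.cong) (auto simp: indicator_def)
          then show ?thesis using False by simp
        qed
      qed
    qed (use intR intB in auto)
    also have "\<dots> = 1 + L * measure P Bad"
      using intB by (subst Bochner_Integration.integral_add) (auto simp: P.prob_space)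
    finally show ?thesis .
  qed
  have small: "N * measure P R + (1 + L) * measure P Bad \<le> e"
  proof -
    have "measure P R \<le> 1 / L + measure P Bad" using bound_R L by (simp add: field_simps)
    then have "N * measure P R \<le> N * (1 / L + measure P Bad)" by (intro mult_left_mono) auto
    then have "N * measure P R + (1 + L) * measure P Bad \<le> N / L + (N + (1 + L)) * measure P Bad"
      by (simp add: algebra_simps)
    also have "\<dots> \<le> e / 2 + (N + (1 + L)) * (L * (e / (2 * D)))"
      using NL Bad_le by (intro add_mono mult_left_mono) auto
    also have "(N + (1 + L)) * (L * (e / (2 * D))) = D * (e / (2 * D))"
      by (simp add: D_def algebra_simps)
    also have "\<dots> = e / 2" using D by simp
    finally show ?thesis by simp
  qed
  show ?thesis
  proof (rule that[OF \<psi>m \<psi>F])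
    fix h :: "(nat \<Rightarrow> 'f) \<Rightarrow> real" and K :: real
    assume hK: "\<And>x. \<bar>h x\<bar> \<le> K"
    \<comment> \<open>After centring \<open>h\<close>, the comparison function \<open>G\<close> below has integral zero by stationarity, and
      it agrees with the observed block function \<open>H\<close> unless the orbit meets \<open>E\<close> too early or reaches
      \<open>R\<close> in fewer than \<open>N\<close> steps; \<open>J\<close> bounds the difference.\<close>
    define c where "c = (\<integral>w. h (cutoff N (\<lambda>i. X i w)) \<partial>Q)"
    have "K \<ge> 0" using hK[of undefined] by linarith
    have count: "(\<lambda>y. k (Z y)) \<in> borel_measurable M" if "Z \<in> measurable M (count_space UNIV)"
      for k :: "(nat \<Rightarrow> 'f) \<Rightarrow> real" and Z and M :: "'z measure"
      by (rule measurable_compose[OF that]) simp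
    have "\<bar>c\<bar> \<le> (\<integral>w. \<bar>h (cutoff N (\<lambda>i. X i w))\<bar> \<partial>Q)" unfolding c_def by (rule integral_abs_bound)
    also have "\<dots> \<le> (\<integral>w. K \<partial>Q)"
      using hK \<open>K \<ge> 0\<close> by (intro integral_mono_AE') auto
    finally have cK: "\<bar>c\<bar> \<le> K" by (simp add: Q.prob_space)
    define h' where "h' x = h x - c" for x
    have h'K: "\<bar>h' x\<bar> \<le> 2 * K" for x using hK[of x] cK by (simp add: h'_def)
    have h'0: "(\<integral>w. h' (cutoff N (\<lambda>i. X i w)) \<partial>Q) = 0"
    proof -
      have "integrable Q (\<lambda>w. h (cutoff N (\<lambda>i. X i w)))"
        using hK count[OF Y]
        by (intro Q.integrable_const_bound[where B=K]) auto
      then show ?thesis by (simp add: h'_def c_def Q.prob_space)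
    qed
    define H where "H y = h' (cutoff N (\<lambda>i. \<psi> ((S ^^ i) y)))" for y
    \<comment> \<open>With the end point \<open>s\<close> steps ahead, the current point reads
      letter \<open>L - 1 - s\<close>, so its block starts there. For \<open>N \<le> s\<close> the
      block stays inside the word.\<close>
    define k where "k s v = h' (cutoff N (\<lambda>i. v (i + (L - 1 - s))))" for s v
    define G where "G y = (\<Sum>s\<in>{N..<L}. indicat_real R ((S ^^ s) y) * k s (g ((S ^^ s) y)))" for y
    have Hm [measurable]: "H \<in> borel_measurable P"
      unfolding H_def using \<psi>F
      by (intro count measurable_cutoff[where F=F] measurable_compose[OF Sm \<psi>m] F) auto
    have Hint: "integrable P H"
      using h'K by (intro P.integrable_const_bound[where B="2 * K"]) (auto simp: H_def)
    have km [measurable]: "(\<lambda>y. k s (g y)) \<in> borel_measurable P" for s by (rule count[OF g])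
    have kint: "integrable P (\<lambda>y. indicat_real R ((S ^^ s) y) * k s (g ((S ^^ s) y)))" for s
    proof (rule P.integrable_const_bound[where B="2 * K"])
      show "(\<lambda>y. indicat_real R ((S ^^ s) y) * k s (g ((S ^^ s) y))) \<in> borel_measurable P"
        using measurable_compose[OF Sm km, of s s] by measurable
      show "AE y in P. norm (indicat_real R ((S ^^ s) y) * k s (g ((S ^^ s) y))) \<le> 2 * K"
        using h'K \<open>K \<ge> 0\<close> by (auto simp: k_def indicator_def)
    qed
    have Gint: "integrable P G" unfolding G_def by (intro Bochner_Integration.integrable_sum kint)
    have "(\<integral>y. G y \<partial>P) = (\<Sum>s\<in>{N..<L}. \<integral>y. indicat_real R ((S ^^ s) y) * k s (g ((S ^^ s) y)) \<partial>P)"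
      unfolding G_def by (intro Bochner_Integration.integral_sum kint)
    also have "\<dots> = (\<Sum>s\<in>{N..<L}. 0)"
    proof (intro sum.cong refl)
      fix s assume s: "s \<in> {N..<L}"
      \<comment> \<open>Invariance moves the end point to \<open>y\<close> itself, where
        \<open>gi\<close> replaces the label by the first \<open>L\<close> target symbols. Then
        \<open>stat\<close> removes the offset \<open>L - 1 - s\<close>, leaving the centred
        integral.\<close>
      have "(\<integral>y. indicat_real R ((S ^^ s) y) * k s (g ((S ^^ s) y)) \<partial>P) = (\<integral>y. indicat_real R y * k s (g y) \<partial>P)"
        by (rule integral_funpow[OF S]) measurable
      also have "\<dots> = measure P R * (\<integral>w. k s (cutoff L (\<lambda>i. X i w)) \<partial>Q)" by (rule gi)
      also have "k s (cutoff L (\<lambda>i. X i w)) = h' (cutoff N (\<lambda>i. X (i + (L - 1 - s)) w))" for w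
        unfolding k_def using s by (intro arg_cong[where f=h'] cutoff_eqI) (auto simp: cutoff_def)
      then have "(\<integral>w. k s (cutoff L (\<lambda>i. X i w)) \<partial>Q) = 0"
        by (simp add: stat[of h'] h'0)
      finally show "(\<integral>y. indicat_real R ((S ^^ s) y) * k s (g ((S ^^ s) y)) \<partial>P) = 0" by simp
    qed
    finally have G0: "(\<integral>y. G y \<partial>P) = 0" by simp
    \<comment> \<open>\<open>2 * K\<close> bounds \<open>h'\<close>. The sum pays for end points
      fewer than \<open>N\<close> steps ahead; on \<open>Bad\<close>, the weight
      \<open>1 + L\<close> pays for \<open>H\<close> and for up to \<open>L\<close> terms of
      \<open>G\<close>.\<close>
    define J where "J y = 2 * K * ((\<Sum>s<N. indicat_real R ((S ^^ s) y)) + (1 + L) * indicat_real Bad y)" for y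
    have J1: "integrable P (\<lambda>y. (\<Sum>s<N. indicat_real R ((S ^^ s) y)))"
      using intR by (rule Bochner_Integration.integrable_sum)
    have J2: "integrable P (\<lambda>y. (1 + L) * indicat_real Bad y)"
      using intB by simp
    have Jint: "integrable P J"
      unfolding J_def by (intro integrable_mult_right Bochner_Integration.integrable_add J1 J2)
    have "AE y in P. \<bar>H y - G y\<bar> \<le> J y"
      using hitE AE_space
    proof eventually_elim
      case (elim y)
      show ?case
      proof (cases "y \<in> Bad")
        case True
        have "\<bar>G y\<bar> \<le> (\<Sum>s\<in>{N..<L}. \<bar>indicat_real R ((S ^^ s) y) * k s (g ((S ^^ s) y))\<bar>)"
          unfolding G_def by (rule sum_abs)
        also have "\<dots> \<le> (\<Sum>s\<in>{N..<L}. 2 * K)"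
          using h'K \<open>K \<ge> 0\<close> by (intro sum_mono) (auto simp: k_def indicator_def)
        also have "\<dots> \<le> (\<Sum>s\<in>{..<L}. 2 * K)"
          using \<open>K \<ge> 0\<close> by (intro sum_mono2) auto
        finally have "\<bar>G y\<bar> \<le> L * (2 * K)" by simp
        moreover have "\<bar>H y\<bar> \<le> 2 * K" unfolding H_def by (rule h'K)
        ultimately have "\<bar>H y - G y\<bar> \<le> 2 * K * (1 + L)" by (simp add: algebra_simps)
        also have "\<dots> \<le> J y"
          unfolding J_def using True \<open>K \<ge> 0\<close> by (intro mult_left_mono) (auto intro: sum_nonneg)
        finally show ?thesis .
      next
        case False
        define s where "s = r y mod L"
        have y: "\<exists>k. (S ^^ k) y \<in> E" "y \<in> space P - Bad" using elim False by auto
        have sL: "s < L" using L by (simp add: s_def)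
        have G: "G y = (if N \<le> s then k s (g ((S ^^ s) y)) else 0)"
        proof -
          have "G y = (\<Sum>t\<in>{N..<L}. if t = s then k s (g ((S ^^ s) y)) else 0)"
            unfolding G_def using in_R[OF y] by (intro sum.cong) (auto simp: s_def indicator_def)
          then show ?thesis using sL by simp
        qed
        show ?thesis
        proof (cases "N \<le> s")
          case True
          \<comment> \<open>Since \<open>i \<le> s\<close>, moving \<open>i\<close> steps lowers
            \<open>r\<close> without crossing a multiple of \<open>L\<close>. All these points share
            one end point and read consecutive letters of its word.\<close>
          have "\<psi> ((S ^^ i) y) = g ((S ^^ s) y) (i + (L - 1 - s))" if "i < N" for i
          proof -
            have i: "i \<le> s" using that True by simp
            have "r ((S ^^ i) y) = r y - i"
              using r_shift[OF y(1), of i] good[OF y] i sL by simp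
            also have "\<dots> mod L = s - i"
            proof -
              have "r y - i = (s - i) + L * (r y div L)"
                using mult_div_mod_eq[of L "r y"] i unfolding s_def by linarith
              then show ?thesis using sL by simp
            qed
            finally have "r ((S ^^ i) y) mod L = s - i" .
            moreover have "(S ^^ (s - i)) ((S ^^ i) y) = (S ^^ s) y"
              using i by (simp add: funpow_add[symmetric, THEN fun_cong, simplified])
            moreover have "L - 1 - (s - i) = i + (L - 1 - s)" using i sL by simp
            ultimately show ?thesis by (simp add: \<psi>_def)
          qed
          then have "H y = G y"
            unfolding G H_def k_def using True by (auto intro!: arg_cong[where f=h'] cutoff_eqI)
          then show ?thesis using \<open>K \<ge> 0\<close> by (auto simp: J_def intro!: mult_nonneg_nonneg add_nonneg_nonneg sum_nonneg)
        next
          case False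
          have "1 = indicat_real R ((S ^^ s) y)" using in_R[OF y sL] by (simp add: s_def)
          also have "\<dots> \<le> (\<Sum>s<N. indicat_real R ((S ^^ s) y))"
            using False by (intro member_le_sum) auto
          finally have "2 * K * 1 \<le> J y" unfolding J_def using \<open>K \<ge> 0\<close>
            by (intro mult_left_mono) (auto intro: add_increasing2)
          moreover have "\<bar>H y\<bar> \<le> 2 * K" unfolding H_def by (rule h'K)
          ultimately show ?thesis using False G by simp
        qed
      qed
    qed
    then have "(\<integral>y. \<bar>H y - G y\<bar> \<partial>P) \<le> (\<integral>y. J y \<partial>P)"
      using Hint Gint Jint by (intro integral_mono_AE) auto
    also have "\<dots> = 2 * K * (N * measure P R + (1 + L) * measure P Bad)"
    proof -
      have "(\<integral>y. J y \<partial>P) = 2 * K * ((\<integral>y. (\<Sum>s<N. indicat_real R ((S ^^ s) y)) \<partial>P)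
          + (\<integral>y. (1 + L) * indicat_real Bad y \<partial>P))"
        unfolding J_def by (subst integral_mult_right_zero, subst Bochner_Integration.integral_add[OF J1 J2]) simp
      also have "(\<integral>y. (\<Sum>s<N. indicat_real R ((S ^^ s) y)) \<partial>P) = N * measure P R"
        by (subst Bochner_Integration.integral_sum) (auto simp: indR intR)
      finally show ?thesis by simp
    qed
    also have "\<dots> \<le> 2 * K * e" using small \<open>K \<ge> 0\<close> by (intro mult_left_mono) auto
    finally have *: "(\<integral>y. \<bar>H y - G y\<bar> \<partial>P) \<le> 2 * K * e" .
    have "\<bar>\<integral>y. H y \<partial>P\<bar> = \<bar>\<integral>y. H y - G y \<partial>P\<bar>"
      using Hint Gint G0 by simp
    also have "\<dots> \<le> (\<integral>y. \<bar>H y - G y\<bar> \<partial>P)" by (rule integral_abs_bound)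
    also note *
    also have "(\<integral>y. H y \<partial>P) = (\<integral>x. h (cutoff N (\<lambda>i. \<psi> ((S ^^ i) x))) \<partial>P) - c"
    proof -
      have "integrable P (\<lambda>y. H y + c)" using Hint by simp
      then have "integrable P (\<lambda>y. h (cutoff N (\<lambda>i. \<psi> ((S ^^ i) y))))" by (simp add: H_def h'_def)
      then show ?thesis by (simp add: H_def h'_def P.prob_space)
    qed
    finally show "\<bar>(\<integral>x. h (cutoff N (\<lambda>i. \<psi> ((S ^^ i) x))) \<partial>P) - (\<integral>w. h (cutoff N (\<lambda>i. X i w)) \<partial>Q)\<bar> \<le> 2 * K * e"
      unfolding c_def .
  qed
qed

section \<open>Weak approximation in compact spaces\<close>

lemma compact_UNIV_fun:
  assumes "compact (UNIV :: 'f::metric_space set)"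
  shows "compact (UNIV :: (nat \<Rightarrow> 'f) set)"
proof -
  have "compact_space (product_topology (\<lambda>i::nat. euclidean :: 'f topology) UNIV)"
  proof -
    have "compact_space (euclidean :: 'f topology)"
      using assms by (simp add: compact_space_def)
    then show ?thesis by (simp add: compact_space_product_topology)
  qed
  then show ?thesis
    by (simp add: euclidean_product_topology compact_space_def)
qed

text \<open>Send each point to the first centre, in a finite list of ball centres, at distance less
  than \<open>d\<close>. Each condition is open, so the least index is Borel measurable.\<close>

lemma finite_quantizer:
  assumes "compact (UNIV :: 'f::metric_space set)" "0 < d"
  obtains q :: "'f \<Rightarrow> 'f::metric_space" where "q \<in> measurable borel (count_space UNIV)" "finite (range q)"
    "\<And>y. dist (q y) y < d"
proof -
  obtain D where "finite D" and D: "(UNIV :: 'f set) \<subseteq> (\<Union>x\<in>D. ball x d)"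
    using compact_eq_totally_bounded[THEN iffD1, OF assms(1)] assms(2) by meson
  then obtain xs where xs: "set xs = D" using finite_list by blast
  define n where "n y = (LEAST i. i < length xs \<and> dist (xs ! i) y < d)" for y
  have n: "n y < length xs" "dist (xs ! n y) y < d" for y
  proof -
    obtain x where "x \<in> D" "dist x y < d" using D by (metis UNIV_I UN_E mem_ball subsetD)
    then have "\<exists>i. i < length xs \<and> dist (xs ! i) y < d"
      unfolding xs[symmetric] by (metis in_set_conv_nth)
    from LeastI_ex[OF this] show "n y < length xs" "dist (xs ! n y) y < d" unfolding n_def by auto
  qed
  show ?thesis
  proof (rule that[of "\<lambda>y. xs ! n y"])
    have m: "n \<in> measurable borel (count_space UNIV)"
      unfolding n_def
    proof (rule measurable_Least)
      fix i
      have "open {y :: 'f. i < length xs \<and> dist (xs ! i) y < d}"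
        by (intro open_Collect_conj open_Collect_const open_Collect_less continuous_intros)
      then show "Measurable.pred borel (\<lambda>y. i < length xs \<and> dist (xs ! i) y < d)"
        unfolding pred_def space_borel by (simp only: UNIV_I simp_thms borel_open)
    qed
    show "(\<lambda>y. xs ! n y) \<in> measurable borel (count_space UNIV)"
      by (rule measurable_compose[OF m]) simp
    have "range (\<lambda>y. xs ! n y) \<subseteq> set xs" using n by auto
    then show "finite (range (\<lambda>y. xs ! n y))" by (rule finite_subset) simp
  qed (rule n)
qed

section \<open>Stationarity as invariance under the shift\<close>

definition shift :: "(nat \<Rightarrow> 'f) \<Rightarrow> nat \<Rightarrow> 'f" where
  "shift x = (\<lambda>i. x (Suc i))"

lemma funpow_shift: "(shift ^^ j) x = (\<lambda>i. x (i + j))"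
  by (induction j) (auto simp: shift_def)

lemma measurable_shift:
  "shift \<in> measurable borel (borel :: (nat \<Rightarrow> 'f::topological_space) measure)"
  unfolding shift_def
  by (intro borel_measurable_continuous_onI continuous_on_coordinatewise_then_product
      continuous_on_product_coordinates)

lemma integral_diff_le:
  fixes f g :: "'a \<Rightarrow> real"
  assumes "prob_space M" "integrable M f" "integrable M g" "\<And>x. \<bar>f x - g x\<bar> \<le> e"
  shows "\<bar>(\<integral>x. f x \<partial>M) - (\<integral>x. g x \<partial>M)\<bar> \<le> e"
proof -
  interpret prob_space M by fact
  have "\<bar>(\<integral>x. f x \<partial>M) - (\<integral>x. g x \<partial>M)\<bar> = \<bar>\<integral>x. f x - g x \<partial>M\<bar>"
    using assms by simp
  also have "\<dots> \<le> (\<integral>x. \<bar>f x - g x\<bar> \<partial>M)" by (rule integral_abs_bound)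
  also have "\<dots> \<le> (\<integral>x. e \<partial>M)" using assms by (intro integral_mono) auto
  finally show ?thesis by (simp add: prob_space)
qed

text \<open>Quantising each coordinate commutes with \<open>shift\<close>, so the quantised process
  is stationary over a finite alphabet. The comparison is with this process rather than with
  \<open>\<nu>\<close> itself; the quantisation error is handled in the limit, through
  \<open>dist (q y) y < e\<close>.\<close>

lemma stationary_process_approximation:
  fixes P :: "'a measure" and \<nu> :: "(nat \<Rightarrow> 'f::metric_space) measure"
  assumes P: "prob_space P" "nonatomic P" and S: "measure_preserving P S"
    and hit: "\<And>E. E \<in> sets P \<Longrightarrow> 0 < measure P E \<Longrightarrow> AE x in P. \<exists>k. (S ^^ k) x \<in> E"
    and comp: "compact (UNIV :: 'f set)"
    and \<nu>: "prob_space \<nu>" "sets \<nu> = sets borel" "measure_preserving \<nu> shift" and e: "0 < e"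
  obtains \<psi> :: "'a \<Rightarrow> 'f" and q :: "'f \<Rightarrow> 'f"
  where "\<psi> \<in> measurable P (count_space UNIV)" "finite (range \<psi>)"
    "q \<in> measurable borel (count_space UNIV)" "finite (range q)" "\<And>y. dist (q y) y < e"
    "\<And>h :: (nat \<Rightarrow> 'f) \<Rightarrow> real. \<And>K. (\<And>x. \<bar>h x\<bar> \<le> K) \<Longrightarrow>
       \<bar>(\<integral>x. h (cutoff N (\<lambda>i. \<psi> ((S ^^ i) x))) \<partial>P) - (\<integral>x. h (cutoff N (\<lambda>i. q (x i))) \<partial>\<nu>)\<bar> \<le> 2 * K * e"
proof -
  obtain q :: "'f \<Rightarrow> 'f" where q: "q \<in> measurable borel (count_space UNIV)" "finite (range q)"
    "\<And>y. dist (q y) y < e" using finite_quantizer[OF comp e] by metis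
  have X: "(\<lambda>x. q (x i)) \<in> measurable \<nu> (count_space UNIV)" for i
  proof (rule measurable_compose[OF _ q(1)])
    show "(\<lambda>x. x i) \<in> measurable \<nu> borel"
      unfolding measurable_cong_sets[OF \<nu>(2) refl]
      by (intro borel_measurable_continuous_onI continuous_on_product_coordinates)
  qed
  have stat: "(\<integral>x. h (cutoff N (\<lambda>i. q (x (i + j)))) \<partial>\<nu>) = (\<integral>x. h (cutoff N (\<lambda>i. q (x i))) \<partial>\<nu>)"
    for h :: "(nat \<Rightarrow> 'f) \<Rightarrow> real" and N j
  proof -
    have "(\<lambda>x. h (cutoff N (\<lambda>i. q (x i)))) \<in> borel_measurable \<nu>"
      by (rule measurable_compose[OF measurable_cutoff[OF X q(2)]]) auto
    from integral_funpow[OF \<nu>(3) this, of j] show ?thesis by (simp add: funpow_shift)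
  qed
  obtain \<psi> where "\<psi> \<in> measurable P (count_space UNIV)" "range \<psi> \<subseteq> range q"
    "\<And>h :: (nat \<Rightarrow> 'f) \<Rightarrow> real. \<And>K. (\<And>x. \<bar>h x\<bar> \<le> K) \<Longrightarrow>
       \<bar>(\<integral>x. h (cutoff N (\<lambda>i. \<psi> ((S ^^ i) x))) \<partial>P) - (\<integral>x. h (cutoff N (\<lambda>i. q (x i))) \<partial>\<nu>)\<bar> \<le> 2 * K * e"
    by (rule finite_alphabet_approximation[OF P S hit \<nu>(1) X q(2) _ stat e, of N]) auto
  then show ?thesis using q by (intro that[of \<psi> q]) (auto intro: finite_subset)
qed

section \<open>Weak convergence of the induced processes\<close>

theorem mainTheorem4:
  fixes M :: "'a measure" and T :: "'a \<Rightarrow> 'a" and A :: "nat \<Rightarrow> 'a set"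
    and W :: "'w measure" and Psi :: "'w \<Rightarrow> (nat \<Rightarrow> 'f::metric_space)"
  assumes "prob_space M"
    and "nonatomic M"
    and "measure_preserving M T"
    and "ergodic M T"
    and "\<And>l. A l \<in> sets M"
    and "\<And>l. 0 < measure M (A l)"
    and "(\<lambda>l. measure M (A l)) \<longlonglongrightarrow> 0"
    and "compact (UNIV :: 'f set)"
    and "prob_space W"
    and "Psi \<in> measurable W borel"
    and "distr W borel (\<lambda>\<omega> n. Psi \<omega> (Suc n)) = distr W borel Psi"
  shows "\<exists>\<psi> :: nat \<Rightarrow> 'a \<Rightarrow> 'f.
           (\<forall>l. \<psi> l \<in> measurable (restrict_space M (A l)) borel) \<and>
           weak_conv (\<lambda>l. distr (cond_measure M (A l)) borel (induced_process T (A l) (\<psi> l)))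
                     (distr W borel Psi)"
proof -
  define \<nu> where "\<nu> = distr W borel Psi"
  define P where "P l = cond_measure M (A l)" for l
  define S where "S l = return_map T (A l)" for l
  define e where "e l = 1 / real (Suc l)" for l
  interpret W: prob_space W by fact
  have \<nu>: "prob_space \<nu>" "sets \<nu> = sets borel"
    unfolding \<nu>_def using assms(10) by (auto intro: W.prob_space_distr)
  interpret \<nu>: prob_space \<nu> by fact
  have "distr \<nu> \<nu> shift = distr \<nu> borel shift"
    using \<nu>(2) by (intro distr_cong) auto
  also have "\<dots> = \<nu>"
    unfolding \<nu>_def using assms(10,11) measurable_shift
    by (subst distr_distr) (auto simp: o_def shift_def)
  finally have \<nu>shift: "measure_preserving \<nu> shift"
    using measurable_shift \<nu>(2) unfolding measure_preserving_def
    by (simp add: measurable_cong_sets[OF \<nu>(2) \<nu>(2)])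
  have P: "prob_space (P l)" "nonatomic (P l)" "measure_preserving (P l) (S l)" for l
    unfolding P_def S_def using assms(1-6)
    by (auto intro: prob_space_cond_measure nonatomic_cond_measure measure_preserving_return_map)
  have hit: "AE x in P l. \<exists>k. (S l ^^ k) x \<in> E" if "E \<in> sets (P l)" "0 < measure (P l) E" for l E
    using that return_map_hits_AE[OF assms(1,3,4,5,6)] unfolding P_def S_def by blast
  have e: "0 < e l" for l by (simp add: e_def)
  \<comment> \<open>The index \<open>l\<close> is also the block length, and \<open>e l\<close> is
    both quantiser mesh and block error, so all three approximations improve together.\<close>
  have "\<exists>\<psi> q. \<psi> \<in> measurable (P l) (count_space UNIV) \<and> finite (range \<psi>) \<and>
    q \<in> measurable borel (count_space UNIV) \<and> finite (range q) \<and> (\<forall>y :: 'f. dist (q y) y < e l) \<and>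
    (\<forall>h :: (nat \<Rightarrow> 'f) \<Rightarrow> real. \<forall>K. (\<forall>x. \<bar>h x\<bar> \<le> K) \<longrightarrow>
       \<bar>(\<integral>x. h (cutoff l (\<lambda>i. \<psi> ((S l ^^ i) x))) \<partial>P l) - (\<integral>x. h (cutoff l (\<lambda>i. q (x i))) \<partial>\<nu>)\<bar> \<le> 2 * K * e l)"
    for l
    by (rule stationary_process_approximation[OF P hit assms(8) \<nu> \<nu>shift e, of l l]) blast+
  then obtain \<psi> q where \<psi>: "\<And>l. \<psi> l \<in> measurable (P l) (count_space UNIV)" "\<And>l. finite (range (\<psi> l))"
    and q: "\<And>l. q l \<in> measurable borel (count_space UNIV)" "\<And>l. finite (range (q l))"
      "\<And>l y. dist (q l y) y < e l"
    and approx: "\<And>l. \<And>h :: (nat \<Rightarrow> 'f) \<Rightarrow> real. \<And>K. (\<And>x. \<bar>h x\<bar> \<le> K) \<Longrightarrow>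
       \<bar>(\<integral>x. h (cutoff l (\<lambda>i. \<psi> l ((S l ^^ i) x))) \<partial>P l) - (\<integral>x. h (cutoff l (\<lambda>i. q l (x i))) \<partial>\<nu>)\<bar> \<le> 2 * K * e l"
    by metis
  have \<psi>S: "(\<lambda>x. \<psi> l ((S l ^^ i) x)) \<in> measurable (P l) (count_space UNIV)" for l i
    by (rule measurable_compose[OF measurable_funpow[OF P(3)] \<psi>(1)])
  have qX: "(\<lambda>x. q l (x i)) \<in> measurable \<nu> (count_space UNIV)" for l i
  proof (rule measurable_compose[OF _ q(1)])
    show "(\<lambda>x. x i) \<in> measurable \<nu> borel"
      unfolding measurable_cong_sets[OF \<nu>(2) refl]
      by (intro borel_measurable_continuous_onI continuous_on_product_coordinates)
  qed
  have proc: "induced_process T (A l) (\<psi> l) = (\<lambda>x i. \<psi> l ((S l ^^ i) x))" for l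
    by (auto simp: induced_process_def S_def)
  have procm: "(\<lambda>x i. \<psi> l ((S l ^^ i) x)) \<in> measurable (P l) borel" for l
    by (rule borel_measurable_finite_alphabet_process[OF \<psi>S \<psi>(2)]) auto
  have cut_proc: "(\<lambda>x. h (cutoff l (\<lambda>i. \<psi> l ((S l ^^ i) x)))) \<in> borel_measurable (P l)"
    for h :: "(nat \<Rightarrow> 'f) \<Rightarrow> real" and l
    by (rule measurable_compose[OF measurable_cutoff[OF \<psi>S \<psi>(2)[of l]]]) simp_all
  have cut_target: "(\<lambda>x. h (cutoff l (\<lambda>i. q l (x i)))) \<in> borel_measurable \<nu>"
    for h :: "(nat \<Rightarrow> 'f) \<Rightarrow> real" and l
    by (rule measurable_compose[OF measurable_cutoff[OF qX q(2)[of l]]]) simp_all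
  show ?thesis
  proof (intro exI[of _ \<psi>] conjI allI)
    fix l
    have "\<psi> l \<in> measurable (P l) borel"
      by (rule measurable_compose[OF \<psi>(1), where g="\<lambda>x. x"]) simp
    then show "\<psi> l \<in> measurable (restrict_space M (A l)) borel"
      by (subst measurable_cong_sets[of _ "P l" borel borel]) (auto simp: P_def cond_measure_def)
  next
    show "weak_conv (\<lambda>l. distr (cond_measure M (A l)) borel (induced_process T (A l) (\<psi> l)))
        (distr W borel Psi)"
      unfolding weak_conv_def proc \<nu>_def[symmetric] P_def[symmetric]
    proof (intro allI impI, elim conjE)
      fix f :: "(nat \<Rightarrow> 'f) \<Rightarrow> real"
      assume f: "continuous_on UNIV f" "bounded (range f)"
      obtain K where K: "\<And>x. \<bar>f x\<bar> \<le> K" using f(2) by (auto simp: bounded_iff)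
      have fm: "f \<in> borel_measurable borel" using f(1) by (rule borel_measurable_continuous_onI)
      have fm': "f \<in> borel_measurable \<nu>" using fm by (simp add: measurable_cong_sets[OF \<nu>(2) refl])
      have uc: "uniformly_continuous_on UNIV f"
        by (rule compact_uniformly_continuous[OF f(1) compact_UNIV_fun[OF assms(8)]])
      have e0: "e \<longlonglongrightarrow> 0" unfolding e_def using LIMSEQ_inverse_real_of_nat by (simp add: inverse_eq_divide)
      show "(\<lambda>l. \<integral>x. f x \<partial>distr (P l) borel (\<lambda>x i. \<psi> l ((S l ^^ i) x))) \<longlonglongrightarrow> (\<integral>x. f x \<partial>\<nu>)"
        unfolding integral_distr[OF procm fm]
      proof (rule LIMSEQ_I)
        fix \<epsilon> :: real assume \<epsilon>: "0 < \<epsilon>"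
        \<comment> \<open>Three errors of at most \<open>\<delta>\<close> each arise: cutting off
          the observed process, comparing block laws, and quantising and cutting off the
          target.\<close>
        define \<delta> where "\<delta> = \<epsilon> / 4"
        have "\<delta> > 0" using \<epsilon> by (simp add: \<delta>_def)
        then obtain r where r: "r > 0" "\<And>x y. dist x y < r \<Longrightarrow> \<bar>f x - f y\<bar> < \<delta>"
          using uc unfolding uniformly_continuous_on_def by (metis UNIV_I dist_real_def)
        obtain N d where N: "d > 0" "\<And>x y :: nat \<Rightarrow> 'f. (\<And>i. i < N \<Longrightarrow> dist (x i) (y i) < d) \<Longrightarrow> dist x y < r"
          using dist_fun_less_of_coordinates[OF r(1), where 'f='f] by metis
        have "eventually (\<lambda>l. e l < d) sequentially"
          using order_tendstoD(2)[OF e0, of d] N(1) by simp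
        moreover have "(\<lambda>l. 2 * K * e l) \<longlonglongrightarrow> 2 * K * 0" by (intro tendsto_intros e0)
        then have "eventually (\<lambda>l. 2 * K * e l < \<delta>) sequentially"
          using order_tendstoD(2)[of _ "2 * K * 0" sequentially \<delta>] \<open>\<delta> > 0\<close> by simp
        ultimately have "eventually (\<lambda>l. e l < d \<and> 2 * K * e l < \<delta> \<and> N \<le> l) sequentially"
          using eventually_ge_at_top[of N] by eventually_elim simp
        moreover have "norm ((\<integral>x. f (\<lambda>i. \<psi> l ((S l ^^ i) x)) \<partial>P l) - (\<integral>x. f x \<partial>\<nu>)) < \<epsilon>"
          if l: "e l < d \<and> 2 * K * e l < \<delta> \<and> N \<le> l" for l
        proof -
          interpret Pl: prob_space "P l" by (rule P)
          \<comment> \<open>As \<open>N \<le> l\<close>, the cutoff leaves the first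
            \<open>N\<close> coordinates unchanged, and these determine \<open>f\<close> up to
            \<open>\<delta>\<close>. For the target below, they move by less than
            \<open>e l < d\<close>.\<close>
          have "\<bar>f (\<lambda>i. \<psi> l ((S l ^^ i) x)) - f (cutoff l (\<lambda>i. \<psi> l ((S l ^^ i) x)))\<bar> \<le> \<delta>" for x
            using l N(1) by (intro less_imp_le r N(2)) (auto simp: cutoff_def)
          then have 1: "\<bar>(\<integral>x. f (\<lambda>i. \<psi> l ((S l ^^ i) x)) \<partial>P l) -
              (\<integral>x. f (cutoff l (\<lambda>i. \<psi> l ((S l ^^ i) x))) \<partial>P l)\<bar> \<le> \<delta>"
            using K measurable_compose[OF procm fm] cut_proc
            by (intro integral_diff_le P Pl.integrable_const_bound[where B=K]) auto
          have "\<bar>f (cutoff l (\<lambda>i. q l (x i))) - f x\<bar> \<le> \<delta>" for x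
            using l less_trans[OF q(3)] by (intro less_imp_le r N(2)) (auto simp: cutoff_def)
          then have 2: "\<bar>(\<integral>x. f (cutoff l (\<lambda>i. q l (x i))) \<partial>\<nu>) - (\<integral>x. f x \<partial>\<nu>)\<bar> \<le> \<delta>"
            using K fm' cut_target
            by (intro integral_diff_le \<nu> \<nu>.integrable_const_bound[where B=K]) auto
          show ?thesis using 1 2 approx[of f K l, OF K] l unfolding \<delta>_def real_norm_def by linarith
        qed
        ultimately show "\<exists>no. \<forall>l\<ge>no. norm ((\<integral>x. f (\<lambda>i. \<psi> l ((S l ^^ i) x)) \<partial>P l) - (\<integral>x. f x \<partial>\<nu>)) < \<epsilon>"
          unfolding eventually_sequentially by blast
      qed
    qed
  qed
qed

end
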